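(* Let $M$ be a finitely presented monoid, let $A$ be an $M$-act, and let $B$ be a large subact of $A$ (i.e. a subact with $A\setminus B$ finite). If $A$ is finitely presented (as an $M$-act), then $B$ is finitely presented (as an $M$-act).
   Context: A monoid $M$ is finitely presented if $M\cong Z^{*}/\rho$ where $Z$ is a finite alphabet, $Z^*$ is the free monoid on $Z$, and $\rho$ is the smallest monoid congruence on $Z^*$ containing some finite set $P\subseteq Z^*\times Z^*$. Let $M$ be a monoid with identity $1$. A (right) $M$-act is a non-empty set $A$ with a map $A\times M\to A$, $(a,m)\mapsto am$, with $a(mn)=(am)n$ and $a1=a$. A subact of $A$ is a non-empty subset $B$ with $bm\in B$ for all $b\in B$, $m\in M$. A congruence on an $M$-act $A$ is an equivalence relation $\rho$ with $(a,b)\in\rho\Rightarrow(am,bm)\in\rho$ for all $m\in M$. For a set $X$, $F_X=X\times M$ is the free $M$-act with $(x,m)n=(x,mn)$. A presentation $\langle X\,|\,R\rangle$ consists of a non-empty set $X$ and a set $R\subseteq F_X\times F_X$; an $M$-act is defined by it if it is isomorphic to $F_X/\rho$, where $\rho$ is the smallest congruence on $F_X$ containing $R$. An $M$-act is finitely presented if it is defined by some presentation $\langle X\,|\,R\rangle$ with $X$ and $R$ finite. *)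

theory Defs
  imports "HOL-Algebra.Group"
begin

section \<open>Finitely presented monoids\<close>

definition free_monoid :: "'z set \<Rightarrow> 'z list monoid" where
  "free_monoid Z = \<lparr>carrier = lists Z, mult = (@), one = []\<rparr>"

definition monoid_congruence :: "('a, 'x) monoid_scheme \<Rightarrow> ('a \<times> 'a) set \<Rightarrow> bool" where
  "monoid_congruence G \<rho> \<longleftrightarrow> equiv (carrier G) \<rho> \<and>
     (\<forall>a b c d. (a, b) \<in> \<rho> \<longrightarrow> (c, d) \<in> \<rho> \<longrightarrow> (a \<otimes>\<^bsub>G\<^esub> c, b \<otimes>\<^bsub>G\<^esub> d) \<in> \<rho>)"

definition generated_monoid_congruence ::
    "('a, 'x) monoid_scheme \<Rightarrow> ('a \<times> 'a) set \<Rightarrow> ('a \<times> 'a) set" where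
  "generated_monoid_congruence G P = \<Inter>{\<rho>. monoid_congruence G \<rho> \<and> P \<subseteq> \<rho>}"

text \<open>For a congruence \<open>\<rho>\<close>, all the classes in the union below coincide
  (see \<open>mult_quotient_monoid\<close>).\<close>

definition quotient_monoid ::
    "('a, 'x) monoid_scheme \<Rightarrow> ('a \<times> 'a) set \<Rightarrow> 'a set monoid" where
  "quotient_monoid G \<rho> =
     \<lparr>carrier = carrier G // \<rho>,
      mult = (\<lambda>U V. \<Union>u\<in>U. \<Union>v\<in>V. \<rho> `` {u \<otimes>\<^bsub>G\<^esub> v}),
      one = \<rho> `` {\<one>\<^bsub>G\<^esub>}\<rparr>"

text \<open>Every finite alphabet can be renamed to a finite set of natural numbers, so it is no
  restriction to take the letters from \<^typ>\<open>nat\<close>. The library's \<open>\<cong>\<close> only asks for a bijection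
  preserving multiplication; between monoids it preserves the identity automatically.\<close>

definition finitely_presented_monoid :: "('m, 'x) monoid_scheme \<Rightarrow> bool" where
  "finitely_presented_monoid M \<longleftrightarrow> monoid M \<and>
     (\<exists>(Z :: nat set) P. finite Z \<and> finite P \<and> P \<subseteq> lists Z \<times> lists Z \<and>
        M \<cong> quotient_monoid (free_monoid Z) (generated_monoid_congruence (free_monoid Z) P))"


section \<open>Acts\<close>

locale right_act = monoid M for M :: "('m, 'x) monoid_scheme" (structure) +
  fixes A :: "'a set" and act :: "'a \<Rightarrow> 'm \<Rightarrow> 'a"
  assumes act_nonempty: "A \<noteq> {}"
    and act_closed: "\<lbrakk>a \<in> A; m \<in> carrier M\<rbrakk> \<Longrightarrow> act a m \<in> A"
    and act_mult: "\<lbrakk>a \<in> A; m \<in> carrier M; n \<in> carrier M\<rbrakk> \<Longrightarrow> act a (m \<otimes> n) = act (act a m) n"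
    and act_one: "a \<in> A \<Longrightarrow> act a \<one> = a"

definition subact ::
    "('m, 'x) monoid_scheme \<Rightarrow> 'a set \<Rightarrow> ('a \<Rightarrow> 'm \<Rightarrow> 'a) \<Rightarrow> 'a set \<Rightarrow> bool" where
  "subact M A act B \<longleftrightarrow> B \<subseteq> A \<and> B \<noteq> {} \<and> (\<forall>b\<in>B. \<forall>m\<in>carrier M. act b m \<in> B)"

definition large_subact ::
    "('m, 'x) monoid_scheme \<Rightarrow> 'a set \<Rightarrow> ('a \<Rightarrow> 'm \<Rightarrow> 'a) \<Rightarrow> 'a set \<Rightarrow> bool" where
  "large_subact M A act B \<longleftrightarrow> subact M A act B \<and> finite (A - B)"

definition act_congruence ::
    "('m, 'x) monoid_scheme \<Rightarrow> 'a set \<Rightarrow> ('a \<Rightarrow> 'm \<Rightarrow> 'a) \<Rightarrow> ('a \<times> 'a) set \<Rightarrow> bool" where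
  "act_congruence M A act \<rho> \<longleftrightarrow> equiv A \<rho> \<and>
     (\<forall>a b. \<forall>m\<in>carrier M. (a, b) \<in> \<rho> \<longrightarrow> (act a m, act b m) \<in> \<rho>)"

definition generated_act_congruence ::
    "('m, 'x) monoid_scheme \<Rightarrow> 'a set \<Rightarrow> ('a \<Rightarrow> 'm \<Rightarrow> 'a) \<Rightarrow> ('a \<times> 'a) set \<Rightarrow> ('a \<times> 'a) set" where
  "generated_act_congruence M A act R = \<Inter>{\<rho>. act_congruence M A act \<rho> \<and> R \<subseteq> \<rho>}"

text \<open>The action induced on the classes of \<open>\<rho>\<close>; the quotient act itself has carrier \<open>A // \<rho>\<close>.
  For a congruence all the classes in the union coincide (see \<open>quotient_action_class\<close>).\<close>

definition quotient_action ::
    "('a \<times> 'a) set \<Rightarrow> ('a \<Rightarrow> 'm \<Rightarrow> 'a) \<Rightarrow> 'a set \<Rightarrow> 'm \<Rightarrow> 'a set" where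
  "quotient_action \<rho> act U m = (\<Union>u\<in>U. \<rho> `` {act u m})"

definition act_isomorphic ::
    "('m, 'x) monoid_scheme \<Rightarrow> 'a set \<Rightarrow> ('a \<Rightarrow> 'm \<Rightarrow> 'a) \<Rightarrow> 'b set \<Rightarrow> ('b \<Rightarrow> 'm \<Rightarrow> 'b) \<Rightarrow> bool" where
  "act_isomorphic M A act B act' \<longleftrightarrow>
     (\<exists>f. bij_betw f A B \<and> (\<forall>a\<in>A. \<forall>m\<in>carrier M. f (act a m) = act' (f a) m))"

definition free_act_carrier :: "('m, 'x) monoid_scheme \<Rightarrow> 'g set \<Rightarrow> ('g \<times> 'm) set" where
  "free_act_carrier M X = X \<times> carrier M"

definition free_action :: "('m, 'x) monoid_scheme \<Rightarrow> 'g \<times> 'm \<Rightarrow> 'm \<Rightarrow> 'g \<times> 'm" where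
  "free_action M p n = (fst p, snd p \<otimes>\<^bsub>M\<^esub> n)"

definition act_presentation ::
    "('m, 'x) monoid_scheme \<Rightarrow> 'g set \<Rightarrow> (('g \<times> 'm) \<times> ('g \<times> 'm)) set \<Rightarrow> bool" where
  "act_presentation M X R \<longleftrightarrow> X \<noteq> {} \<and> R \<subseteq> free_act_carrier M X \<times> free_act_carrier M X"

definition act_defined_by ::
    "('m, 'x) monoid_scheme \<Rightarrow> 'a set \<Rightarrow> ('a \<Rightarrow> 'm \<Rightarrow> 'a) \<Rightarrow>
     'g set \<Rightarrow> (('g \<times> 'm) \<times> ('g \<times> 'm)) set \<Rightarrow> bool" where
  "act_defined_by M A act X R \<longleftrightarrow>
     (let \<rho> = generated_act_congruence M (free_act_carrier M X) (free_action M) R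
      in act_isomorphic M A act
           (free_act_carrier M X // \<rho>) (quotient_action \<rho> (free_action M)))"

text \<open>As for monoids, it is no restriction to take the finitely many generators from
  \<^typ>\<open>nat\<close>.\<close>

definition finitely_presented_act ::
    "('m, 'x) monoid_scheme \<Rightarrow> 'a set \<Rightarrow> ('a \<Rightarrow> 'm \<Rightarrow> 'a) \<Rightarrow> bool" where
  "finitely_presented_act M A act \<longleftrightarrow> right_act M A act \<and>
     (\<exists>(X :: nat set) R. finite X \<and> finite R \<and>
        act_presentation M X R \<and> act_defined_by M A act X R)"


section \<open>Well-definedness\<close>

lemma monoid_free_monoid: "monoid (free_monoid Z)"
  by (rule monoidI) (auto simp: free_monoid_def)

lemma mult_quotient_monoid:
  assumes "monoid_congruence G \<rho>" "a \<in> carrier G" "b \<in> carrier G"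
  shows "(\<rho> `` {a}) \<otimes>\<^bsub>quotient_monoid G \<rho>\<^esub> (\<rho> `` {b}) = \<rho> `` {a \<otimes>\<^bsub>G\<^esub> b}"
proof -
  have eq: "equiv (carrier G) \<rho>"
    using assms(1) by (simp add: monoid_congruence_def)
  have "congruent2 \<rho> \<rho> (\<lambda>u v. \<rho> `` {u \<otimes>\<^bsub>G\<^esub> v})"
    using assms(1)
    by (auto simp: congruent2_def monoid_congruence_def intro!: equiv_class_eq[OF eq])
  then show ?thesis
    unfolding quotient_monoid_def monoid.simps
    by (rule UN_equiv_class2[OF eq eq _ assms(2,3)])
qed

lemma quotient_action_class:
  assumes "act_congruence M A act \<rho>" "a \<in> A" "m \<in> carrier M"
  shows "quotient_action \<rho> act (\<rho> `` {a}) m = \<rho> `` {act a m}"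
proof -
  have eq: "equiv A \<rho>"
    using assms(1) by (simp add: act_congruence_def)
  have "(\<lambda>u. \<rho> `` {act u m}) respects \<rho>"
    using assms(1,3)
    by (auto simp: congruent_def act_congruence_def intro!: equiv_class_eq[OF eq])
  then show ?thesis
    unfolding quotient_action_def
    by (rule UN_equiv_class[OF eq _ assms(2)])
qed

lemma right_act_free_act:
  assumes "monoid M" "X \<noteq> {}"
  shows "right_act M (free_act_carrier M X) (free_action M)"
proof -
  interpret monoid M by fact
  show ?thesis
    using assms(2) one_closed
    by unfold_locales (auto simp: free_act_carrier_def free_action_def m_assoc)
qed

lemma monoid_congruence_generated:
  assumes "monoid G" "P \<subseteq> carrier G \<times> carrier G"
  shows "monoid_congruence G (generated_monoid_congruence G P)"
proof -
  interpret monoid G by fact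
  let ?S = "{\<rho>. monoid_congruence G \<rho> \<and> P \<subseteq> \<rho>}"
  have top: "carrier G \<times> carrier G \<in> ?S"
    using assms(2) unfolding monoid_congruence_def
    by (auto simp: equiv_def refl_on_def sym_def trans_def)
  have "equiv (carrier G) (\<Inter>?S)"
  proof (rule equivI)
    show "\<Inter>?S \<subseteq> carrier G \<times> carrier G"
      using top by blast
    show "refl_on (carrier G) (\<Inter>?S)"
      unfolding monoid_congruence_def equiv_def refl_on_def by blast
    show "sym (\<Inter>?S)"
      using sym_INTER[of ?S "\<lambda>\<rho>. \<rho>"] by (simp add: monoid_congruence_def equiv_def)
    show "trans (\<Inter>?S)"
      using trans_INTER[of ?S "\<lambda>\<rho>. \<rho>"] by (simp add: monoid_congruence_def equiv_def)
  qed
  then show ?thesis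
    unfolding generated_monoid_congruence_def
    unfolding monoid_congruence_def[of G "\<Inter>?S"]
    by (simp add: monoid_congruence_def)
qed

lemma act_congruence_generated:
  assumes "right_act M A act" "R \<subseteq> A \<times> A"
  shows "act_congruence M A act (generated_act_congruence M A act R)"
proof -
  interpret right_act M A act by fact
  let ?S = "{\<rho>. act_congruence M A act \<rho> \<and> R \<subseteq> \<rho>}"
  have top: "A \<times> A \<in> ?S"
    using assms(2) act_closed unfolding act_congruence_def
    by (auto simp: equiv_def refl_on_def sym_def trans_def)
  have "equiv A (\<Inter>?S)"
  proof (rule equivI)
    show "\<Inter>?S \<subseteq> A \<times> A"
      using top by blast
    show "refl_on A (\<Inter>?S)"
      unfolding act_congruence_def equiv_def refl_on_def by blast
    show "sym (\<Inter>?S)"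
      using sym_INTER[of ?S "\<lambda>\<rho>. \<rho>"] by (simp add: act_congruence_def equiv_def)
    show "trans (\<Inter>?S)"
      using trans_INTER[of ?S "\<lambda>\<rho>. \<rho>"] by (simp add: act_congruence_def equiv_def)
  qed
  then show ?thesis
    unfolding generated_act_congruence_def
    unfolding act_congruence_def[of M A act "\<Inter>?S"]
    by (simp add: act_congruence_def)
qed

end

theory Submission
  imports Defs
begin

text \<open>
  This is a Reidemeister--Schreier argument. Write \<open>C = A - B\<close> and let \<open>Y\<close> consist of the
  generators of \<open>A\<close> that lie in \<open>B\<close> together with the elements \<open>c z \<in> B\<close> for \<open>c \<in> C\<close> and \<open>z\<close> a
  letter. Words act on the disjoint union of \<open>C\<close> and the free act on \<open>Y\<close>: a letter \<open>z\<close> moves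
  \<open>c\<close> to \<open>c z\<close>, which is a point of \<open>C\<close> or a generator in \<open>Y\<close>. Impose on the free act the
  finitely many relations saying that both sides of a defining relation of \<open>M\<close>, applied to a
  point of \<open>C\<close>, and both sides of a defining relation of \<open>A\<close>, lead to the same place. Modulo these
  the union becomes an \<open>M\<close>-act satisfying the relations of \<open>A\<close>, so it is a copy of \<open>A\<close>
  and the quotient of the free act on \<open>Y\<close> is a copy of \<open>B\<close>.
\<close>

section \<open>Presentations described by generating maps and their kernels\<close>

declare in_listsD [rule del] in_listsI [rule del]

text \<open>Pulling the class of a word back along the isomorphism yields \<phi>. Its kernel is the
  congruence generated by \<open>P\<close>; the last clause expresses the minimality of that
  congruence, so the later argument can do without the quotient monoid.\<close>

lemma finitely_presented_monoidE:
  fixes M :: "('m, 'x) monoid_scheme" (structure)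
  assumes "finitely_presented_monoid M"
  obtains Z :: "nat set" and P \<phi> where
    "finite Z" "finite P" "P \<subseteq> lists Z \<times> lists Z"
    "\<phi> ` lists Z = carrier M" "\<phi> [] = \<one>\<^bsub>M\<^esub>"
    "\<And>u v. u \<in> lists Z \<Longrightarrow> v \<in> lists Z \<Longrightarrow> \<phi> (u @ v) = \<phi> u \<otimes>\<^bsub>M\<^esub> \<phi> v"
    "\<And>u v. (u, v) \<in> P \<Longrightarrow> \<phi> u = \<phi> v"
    "\<And>\<rho> u v. monoid_congruence (free_monoid Z) \<rho> \<Longrightarrow> P \<subseteq> \<rho> \<Longrightarrow>
      u \<in> lists Z \<Longrightarrow> v \<in> lists Z \<Longrightarrow> \<phi> u = \<phi> v \<Longrightarrow> (u, v) \<in> \<rho>"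
proof -
  interpret monoid M
    using assms by (simp add: finitely_presented_monoid_def)
  obtain Z :: "nat set" and P where ZP: "finite Z" "finite P" "P \<subseteq> lists Z \<times> lists Z"
    and iso: "M \<cong> quotient_monoid (free_monoid Z) (generated_monoid_congruence (free_monoid Z) P)"
    using assms by (auto simp: finitely_presented_monoid_def)
  define \<gamma> where "\<gamma> = generated_monoid_congruence (free_monoid Z) P"
  define Q where "Q = quotient_monoid (free_monoid Z) \<gamma>"
  have cong: "monoid_congruence (free_monoid Z) \<gamma>"
    unfolding \<gamma>_def using ZP(3)
    by (intro monoid_congruence_generated monoid_free_monoid) (simp add: free_monoid_def)
  have eq: "equiv (lists Z) \<gamma>"
    using cong by (simp add: monoid_congruence_def free_monoid_def)
  have P_sub: "P \<subseteq> \<gamma>"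
    by (auto simp: \<gamma>_def generated_monoid_congruence_def)
  obtain h where h: "h \<in> hom M Q" "bij_betw h (carrier M) (carrier Q)"
    using iso by (auto simp: is_iso_def iso_def Q_def \<gamma>_def)
  have carrier_Q: "carrier Q = lists Z // \<gamma>"
    by (simp add: Q_def quotient_monoid_def free_monoid_def)
  define \<phi> where "\<phi> = (\<lambda>u. inv_into (carrier M) h (\<gamma> `` {u}))"
  have class_in: "\<gamma> `` {u} \<in> carrier Q" if "u \<in> lists Z" for u
    using that by (simp add: carrier_Q quotientI)
  have h_\<phi>: "h (\<phi> u) = \<gamma> `` {u}" if "u \<in> lists Z" for u
    using class_in[OF that] h(2) by (simp add: \<phi>_def bij_betw_inv_into_right)
  have \<phi>_closed: "\<phi> u \<in> carrier M" if "u \<in> lists Z" for u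
    using class_in[OF that] h(2) by (metis \<phi>_def bij_betw_imp_surj_on inv_into_into)
  have \<phi>_eq: "\<phi> u = \<phi> v \<longleftrightarrow> (u, v) \<in> \<gamma>" if "u \<in> lists Z" "v \<in> lists Z" for u v
    using that h_\<phi> eq_equiv_class_iff[OF eq that] by (metis \<phi>_def)
  have \<phi>_mult: "\<phi> (u @ v) = \<phi> u \<otimes> \<phi> v" if "u \<in> lists Z" "v \<in> lists Z" for u v
  proof -
    have "h (\<phi> u \<otimes> \<phi> v) = (\<gamma> `` {u}) \<otimes>\<^bsub>Q\<^esub> (\<gamma> `` {v})"
      using h(1) that by (simp add: hom_mult \<phi>_closed h_\<phi>)
    also have "\<dots> = \<gamma> `` {u @ v}"
      using mult_quotient_monoid[OF cong, of u v] that by (simp add: Q_def free_monoid_def)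
    also have "\<dots> = h (\<phi> (u @ v))"
      using that by (simp add: h_\<phi>)
    finally show ?thesis
      using inj_on_eq_iff[OF bij_betw_imp_inj_on[OF h(2)]] that by (simp add: \<phi>_closed)
  qed
  have surj: "\<phi> ` lists Z = carrier M"
  proof
    show "carrier M \<subseteq> \<phi> ` lists Z"
    proof
      fix m assume m: "m \<in> carrier M"
      then have "h m \<in> lists Z // \<gamma>"
        using h(2) carrier_Q by (auto simp: bij_betw_def)
      then obtain u where u: "u \<in> lists Z" "h m = \<gamma> `` {u}"
        by (auto elim: quotientE)
      have "\<phi> u = m"
        using h(2) m u(2) by (metis \<phi>_def bij_betw_inv_into_left)
      then show "m \<in> \<phi> ` lists Z"
        using u(1) by blast
    qed
  qed (use \<phi>_closed in blast)
  \<comment> \<open>\<open>h\<close> is only known to respect multiplication. A word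
    \<open>w\<close> with value \<open>\<one>\<close> gives \<open>\<phi> [] = \<phi> [] \<otimes>
    \<phi> w = \<phi> ([] @ w) = \<one>\<close>.\<close>
  have \<phi>_one: "\<phi> [] = \<one>"
  proof -
    obtain w where w: "w \<in> lists Z" "\<phi> w = \<one>"
      using surj one_closed by (metis imageE)
    show ?thesis
      using \<phi>_mult[of "[]" w] w \<phi>_closed[of "[]"] by simp
  qed
  have \<phi>_P: "\<phi> u = \<phi> v" if "(u, v) \<in> P" for u v
    using that ZP(3) P_sub \<phi>_eq by blast
  have min: "(u, v) \<in> \<rho>"
    if "monoid_congruence (free_monoid Z) \<rho>" "P \<subseteq> \<rho>" "u \<in> lists Z" "v \<in> lists Z" "\<phi> u = \<phi> v"
    for \<rho> u v
    using that \<phi>_eq by (auto simp: \<gamma>_def generated_monoid_congruence_def)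
  show ?thesis
    using that[of Z P \<phi>] ZP surj \<phi>_one \<phi>_mult \<phi>_P min by blast
qed

text \<open>The counterpart for acts: \<open>g x\<close> is the point whose class is that of
  \<open>(x, \<one>)\<close>, so by equivariance \<open>act (g x) m\<close> has the class of
  \<open>(x, m)\<close>. The kernel of this evaluation is therefore the congruence generated by
  \<open>R\<close>.\<close>

lemma finitely_presented_actE:
  fixes M :: "('m, 'x) monoid_scheme" (structure) and A :: "'a set"
  assumes "finitely_presented_act M A act"
  obtains X :: "nat set" and R g where
    "finite X" "finite R" "R \<subseteq> (X \<times> carrier M) \<times> (X \<times> carrier M)" "g ` X \<subseteq> A"
    "\<And>a. a \<in> A \<Longrightarrow> \<exists>x\<in>X. \<exists>m\<in>carrier M. a = act (g x) m"
    "\<And>x m y n. ((x, m), (y, n)) \<in> R \<Longrightarrow> act (g x) m = act (g y) n"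
    "\<And>\<rho> x m y n. act_congruence M (X \<times> carrier M) (free_action M) \<rho> \<Longrightarrow> R \<subseteq> \<rho> \<Longrightarrow>
      x \<in> X \<Longrightarrow> y \<in> X \<Longrightarrow> m \<in> carrier M \<Longrightarrow> n \<in> carrier M \<Longrightarrow>
      act (g x) m = act (g y) n \<Longrightarrow> ((x, m), (y, n)) \<in> \<rho>"
proof -
  interpret right_act M A act
    using assms by (simp add: finitely_presented_act_def)
  obtain X :: "nat set" and R where XR: "finite X" "finite R" "act_presentation M X R"
    and def_by: "act_defined_by M A act X R"
    using assms by (auto simp: finitely_presented_act_def)
  define F where "F = X \<times> carrier M"
  have R_sub: "R \<subseteq> F \<times> F" and X_ne: "X \<noteq> {}"
    using XR(3) by (auto simp: act_presentation_def free_act_carrier_def F_def)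
  define \<gamma> where "\<gamma> = generated_act_congruence M F (free_action M) R"
  have cong: "act_congruence M F (free_action M) \<gamma>"
    unfolding \<gamma>_def using R_sub right_act_free_act[OF monoid_axioms X_ne]
    by (intro act_congruence_generated) (auto simp: F_def free_act_carrier_def)
  have eq: "equiv F \<gamma>"
    using cong by (simp add: act_congruence_def)
  have R_\<gamma>: "R \<subseteq> \<gamma>"
    by (auto simp: \<gamma>_def generated_act_congruence_def)
  obtain h where h: "bij_betw h A (F // \<gamma>)"
    "\<And>a m. a \<in> A \<Longrightarrow> m \<in> carrier M \<Longrightarrow> h (act a m) = quotient_action \<gamma> (free_action M) (h a) m"
    using def_by by (auto simp: act_defined_by_def Let_def act_isomorphic_def F_def \<gamma>_def
        free_act_carrier_def)
  define g where "g = (\<lambda>x. inv_into A h (\<gamma> `` {(x, \<one>)}))"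
  have class_in: "\<gamma> `` {u} \<in> F // \<gamma>" if "u \<in> F" for u
    using that by (rule quotientI)
  have one_F: "(x, \<one>) \<in> F" if "x \<in> X" for x
    using that by (simp add: F_def)
  have g_in: "g x \<in> A" if "x \<in> X" for x
    using class_in[OF one_F[OF that]] h(1) by (metis g_def bij_betw_imp_surj_on inv_into_into)
  have h_g: "h (act (g x) m) = \<gamma> `` {(x, m)}" if "x \<in> X" "m \<in> carrier M" for x m
  proof -
    have "h (g x) = \<gamma> `` {(x, \<one>)}"
      using class_in[OF one_F[OF that(1)]] h(1) by (simp add: g_def bij_betw_inv_into_right)
    then show ?thesis
      using h(2)[OF g_in[OF that(1)] that(2)]
        quotient_action_class[OF cong one_F[OF that(1)] that(2)] that
      by (simp add: free_action_def)
  qed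
  have ker: "act (g x) m = act (g y) n \<longleftrightarrow> ((x, m), (y, n)) \<in> \<gamma>"
    if "x \<in> X" "y \<in> X" "m \<in> carrier M" "n \<in> carrier M" for x m y n
  proof -
    have "act (g x) m = act (g y) n \<longleftrightarrow> h (act (g x) m) = h (act (g y) n)"
      using inj_on_eq_iff[OF bij_betw_imp_inj_on[OF h(1)]] that by (simp add: act_closed g_in)
    then show ?thesis
      using that eq_equiv_class_iff[OF eq, of "(x, m)" "(y, n)"] by (simp add: h_g F_def)
  qed
  have gen: "\<exists>x\<in>X. \<exists>m\<in>carrier M. a = act (g x) m" if "a \<in> A" for a
  proof -
    have "h a \<in> F // \<gamma>"
      using h(1) that by (auto simp: bij_betw_def)
    then obtain x m where "x \<in> X" "m \<in> carrier M" "h a = \<gamma> `` {(x, m)}"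
      by (auto elim!: quotientE simp: F_def)
    moreover from this have "a = act (g x) m"
      using inj_on_eq_iff[OF bij_betw_imp_inj_on[OF h(1)] that, of "act (g x) m"] h_g[of x m]
      by (simp add: act_closed g_in)
    ultimately show ?thesis by blast
  qed
  have rel: "act (g x) m = act (g y) n" if "((x, m), (y, n)) \<in> R" for x m y n
    using that R_sub R_\<gamma> ker[of x y m n] by (auto simp: F_def)
  have min: "((x, m), (y, n)) \<in> \<rho>"
    if "act_congruence M (X \<times> carrier M) (free_action M) \<rho>" "R \<subseteq> \<rho>"
      "x \<in> X" "y \<in> X" "m \<in> carrier M" "n \<in> carrier M" "act (g x) m = act (g y) n"
    for \<rho> x m y n
    using that ker[of x y m n] by (auto simp: \<gamma>_def generated_act_congruence_def F_def)
  show ?thesis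
    using that[of X R g] XR(1,2) R_sub g_in gen rel min unfolding F_def by blast
qed

text \<open>The generators are elements of the act here, to be renamed to natural numbers.\<close>

lemma finitely_presented_actI:
  fixes M :: "('m, 'x) monoid_scheme" (structure) and B :: "'a set"
  assumes act: "right_act M B act"
    and Y: "finite Y" "Y \<subseteq> B" "\<And>b. b \<in> B \<Longrightarrow> \<exists>y\<in>Y. \<exists>m\<in>carrier M. b = act y m"
    and S: "finite S" "S \<subseteq> (Y \<times> carrier M) \<times> (Y \<times> carrier M)"
      "\<And>x m y n. ((x, m), (y, n)) \<in> S \<Longrightarrow> act x m = act y n"
    and min: "\<And>\<sigma> x m y n. act_congruence M (Y \<times> carrier M) (free_action M) \<sigma> \<Longrightarrow> S \<subseteq> \<sigma> \<Longrightarrow>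
      x \<in> Y \<Longrightarrow> y \<in> Y \<Longrightarrow> m \<in> carrier M \<Longrightarrow> n \<in> carrier M \<Longrightarrow>
      act x m = act y n \<Longrightarrow> ((x, m), (y, n)) \<in> \<sigma>"
  shows "finitely_presented_act M B act"
proof -
  interpret right_act M B act by fact
  obtain e :: "'a \<Rightarrow> nat" where e: "inj_on e Y"
    using finite_imp_inj_to_nat_seg[OF Y(1)] by blast
  define d where "d = inv_into Y e"
  define X where "X = e ` Y"
  define F where "F = X \<times> carrier M"
  define E where "E = map_prod e (id :: 'm \<Rightarrow> 'm)"
  define R where "R = map_prod E E ` S"
  have d_e: "d (e y) = y" if "y \<in> Y" for y
    using e that by (simp add: d_def)
  have d_in: "d x \<in> Y" "e (d x) = x" if "x \<in> X" for x
    using that d_e by (auto simp: X_def)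
  have Y_ne: "Y \<noteq> {}"
    using act_nonempty Y(3) by blast
  have X_ne: "X \<noteq> {}"
    using Y_ne by (simp add: X_def)
  have R_sub: "R \<subseteq> F \<times> F"
    using S(2) by (auto simp: R_def E_def F_def X_def)
  define f where "f = (\<lambda>p. act (d (fst p)) (snd p))"
  have f_closed: "f p \<in> B" if "p \<in> F" for p
    using that d_in(1) Y(2) by (auto simp: f_def F_def intro!: act_closed)
  have f_act: "f (free_action M p m) = act (f p) m" if "p \<in> F" "m \<in> carrier M" for p m
    using that d_in(1)[of "fst p"] Y(2) act_mult[of "d (fst p)" "snd p" m]
    by (auto simp: f_def F_def free_action_def)
  \<comment> \<open>The kernel of the evaluation map \<open>f\<close>. Once it is identified with
    the generated congruence \<gamma>, the homomorphism theorem gives the isomorphism.\<close>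
  define \<kappa> where "\<kappa> = {(p, q). p \<in> F \<and> q \<in> F \<and> f p = f q}"
  have \<kappa>_cong: "act_congruence M F (free_action M) \<kappa>"
    unfolding act_congruence_def
  proof (intro conjI allI ballI impI)
    show "equiv F \<kappa>"
      by (rule equivI) (auto simp: \<kappa>_def refl_on_def sym_def trans_def)
    fix p q m assume "m \<in> carrier M" "(p, q) \<in> \<kappa>"
    then show "(free_action M p m, free_action M q m) \<in> \<kappa>"
      using f_act by (auto simp: \<kappa>_def) (auto simp: F_def free_action_def)
  qed
  have R_\<kappa>: "R \<subseteq> \<kappa>"
  proof -
    have "f (E (x, m)) = f (E (y, n))" if "((x, m), (y, n)) \<in> S" for x m y n
      using S(2,3) that by (force simp: f_def E_def d_e)
    then show ?thesis
      using R_sub by (auto simp: \<kappa>_def R_def)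
  qed
  define \<gamma> where "\<gamma> = generated_act_congruence M F (free_action M) R"
  have cong: "act_congruence M F (free_action M) \<gamma>"
    unfolding \<gamma>_def using R_sub right_act_free_act[OF monoid_axioms X_ne]
    by (intro act_congruence_generated) (auto simp: F_def free_act_carrier_def)
  have eq: "equiv F \<gamma>"
    using cong by (simp add: act_congruence_def)
  have "\<gamma> \<subseteq> \<kappa>"
    using \<kappa>_cong R_\<kappa> by (auto simp: \<gamma>_def generated_act_congruence_def)
  moreover have "\<kappa> \<subseteq> \<gamma>"
  proof -
    \<comment> \<open>The hypothesis \<open>min\<close> concerns the free act on \<open>Y\<close>,
      so \<gamma> is pulled back there along the renaming \<open>E\<close>. Since
      \<open>E (d x, m) = (x, m)\<close>, what \<open>min\<close> yields carries over to
      \<open>X\<close>.\<close>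
    define \<sigma> where "\<sigma> = {(p, q). p \<in> Y \<times> carrier M \<and> q \<in> Y \<times> carrier M \<and> (E p, E q) \<in> \<gamma>}"
    have E_act: "E (free_action M p m) = free_action M (E p) m" for p m
      by (cases p) (simp add: E_def free_action_def)
    have E_in: "E p \<in> F" if "p \<in> Y \<times> carrier M" for p
      using that by (auto simp: E_def F_def X_def)
    have "act_congruence M (Y \<times> carrier M) (free_action M) \<sigma>"
      unfolding act_congruence_def
    proof (intro conjI allI ballI impI)
      show "equiv (Y \<times> carrier M) \<sigma>"
      proof (rule equivI)
        show "refl_on (Y \<times> carrier M) \<sigma>"
          using eq E_in unfolding refl_on_def \<sigma>_def equiv_def by blast
        show "sym \<sigma>"
          using eq unfolding sym_def \<sigma>_def equiv_def by blast
        show "trans \<sigma>"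
          using eq unfolding trans_def \<sigma>_def equiv_def by blast
      qed (auto simp: \<sigma>_def)
      fix p q m assume "m \<in> carrier M" "(p, q) \<in> \<sigma>"
      then show "(free_action M p m, free_action M q m) \<in> \<sigma>"
        using cong by (auto simp: \<sigma>_def E_act act_congruence_def) (auto simp: free_action_def)
    qed
    moreover have "S \<subseteq> \<sigma>"
    proof -
      have "R \<subseteq> \<gamma>"
        by (auto simp: \<gamma>_def generated_act_congruence_def)
      then show ?thesis
        using S(2) by (auto simp: \<sigma>_def R_def)
    qed
    ultimately have "((d x, m), (d y, n)) \<in> \<sigma>" if "((x, m), (y, n)) \<in> \<kappa>" for x m y n
      using that min[of \<sigma> "d x" "d y" m n] by (simp add: \<kappa>_def F_def f_def d_in)
    then have "((x, m), (y, n)) \<in> \<gamma>" if "((x, m), (y, n)) \<in> \<kappa>" for x m y n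
      using that by (fastforce simp: \<kappa>_def \<sigma>_def E_def F_def d_in)
    then show ?thesis
      by auto
  qed
  ultimately have \<gamma>_\<kappa>: "\<gamma> = \<kappa>" by blast
  \<comment> \<open>The inverse of the map that \<open>f\<close> induces on classes: each point goes
    to its fibre, which is a class because \<gamma> is the kernel of \<open>f\<close>.\<close>
  define h where "h = (\<lambda>b. {p \<in> F. f p = b})"
  have h_f: "h (f p) = \<gamma> `` {p}" if "p \<in> F" for p
    using that by (auto simp: \<gamma>_\<kappa> \<kappa>_def h_def)
  have f_surj: "\<exists>p\<in>F. b = f p" if b: "b \<in> B" for b
  proof -
    obtain y m where "y \<in> Y" "m \<in> carrier M" "b = act y m"
      using Y(3)[OF b] by blast
    then show ?thesis
      by (intro bexI[of _ "(e y, m)"]) (auto simp: f_def d_e F_def X_def)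
  qed
  have "act_isomorphic M B act (F // \<gamma>) (quotient_action \<gamma> (free_action M))"
    unfolding act_isomorphic_def
  proof (intro exI[of _ h] conjI ballI)
    show "bij_betw h B (F // \<gamma>)"
      unfolding bij_betw_def
    proof
      show "inj_on h B"
        using f_surj by (auto simp: inj_on_def h_def)
      show "h ` B = F // \<gamma>"
      proof (intro equalityI subsetI)
        fix U assume "U \<in> h ` B"
        then obtain b where "b \<in> B" "U = h b" by blast
        moreover from this obtain p where "p \<in> F" "b = f p"
          using f_surj by blast
        ultimately show "U \<in> F // \<gamma>"
          by (simp add: h_f quotientI)
      next
        fix U assume "U \<in> F // \<gamma>"
        then obtain p where "p \<in> F" "U = h (f p)"
          using h_f by (metis quotientE)
        then show "U \<in> h ` B"
          using f_closed by blast
      qed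
    qed
    fix b m assume b: "b \<in> B" and m: "m \<in> carrier M"
    obtain p where p: "p \<in> F" "b = f p"
      using f_surj[OF b] by blast
    have "free_action M p m \<in> F"
      using p(1) m by (auto simp: F_def free_action_def)
    then show "h (act b m) = quotient_action \<gamma> (free_action M) (h b) m"
      using quotient_action_class[OF cong p(1) m] p m h_f f_act by metis
  qed
  moreover have "finite X" "finite R"
    using Y(1) S(1) by (simp_all add: X_def R_def)
  ultimately show ?thesis
    using act X_ne R_sub
    by (auto simp: finitely_presented_act_def act_presentation_def act_defined_by_def Let_def
        F_def \<gamma>_def free_act_carrier_def)
qed

section \<open>Subacts and the action of words on states\<close>

lemma right_act_subact:
  assumes "right_act M A act" "subact M A act B"
  shows "right_act M B act"
proof -
  interpret right_act M A act by fact
  show ?thesis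
    using assms(2) act_mult act_one by unfold_locales (auto simp: subact_def)
qed

text \<open>The assumptions on \<phi> and \<open>g\<close> are what the two elimination lemmas
  provide; \<open>\<phi>_ker\<close> and \<open>g_ker\<close> are the minimality clauses.\<close>

locale presented_large_subact = right_act M A act
  for M :: "('m, 'x) monoid_scheme" (structure) and A :: "'a set" and act +
  fixes B :: "'a set" and Z :: "'z set" and P and \<phi> :: "'z list \<Rightarrow> 'm"
    and X :: "'g set" and R and g :: "'g \<Rightarrow> 'a"
  assumes sub: "subact M A act B" and finite_diff: "finite (A - B)"
    and Z: "finite Z" and P: "finite P" "P \<subseteq> lists Z \<times> lists Z"
    and \<phi>_surj: "\<phi> ` lists Z = carrier M" and \<phi>_Nil: "\<phi> [] = \<one>"
    and \<phi>_append: "\<And>u v. u \<in> lists Z \<Longrightarrow> v \<in> lists Z \<Longrightarrow> \<phi> (u @ v) = \<phi> u \<otimes> \<phi> v"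
    and \<phi>_rel: "\<And>u v. (u, v) \<in> P \<Longrightarrow> \<phi> u = \<phi> v"
    and \<phi>_ker: "\<And>\<rho> u v. monoid_congruence (free_monoid Z) \<rho> \<Longrightarrow> P \<subseteq> \<rho> \<Longrightarrow>
      u \<in> lists Z \<Longrightarrow> v \<in> lists Z \<Longrightarrow> \<phi> u = \<phi> v \<Longrightarrow> (u, v) \<in> \<rho>"
    and X: "finite X" and R: "finite R" "R \<subseteq> (X \<times> carrier M) \<times> (X \<times> carrier M)"
    and g_in: "g ` X \<subseteq> A"
    and g_gen: "\<And>a. a \<in> A \<Longrightarrow> \<exists>x\<in>X. \<exists>m\<in>carrier M. a = act (g x) m"
    and g_rel: "\<And>x m y n. ((x, m), (y, n)) \<in> R \<Longrightarrow> act (g x) m = act (g y) n"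
    and g_ker: "\<And>\<rho> x m y n. act_congruence M (X \<times> carrier M) (free_action M) \<rho> \<Longrightarrow> R \<subseteq> \<rho> \<Longrightarrow>
      x \<in> X \<Longrightarrow> y \<in> X \<Longrightarrow> m \<in> carrier M \<Longrightarrow> n \<in> carrier M \<Longrightarrow>
      act (g x) m = act (g y) n \<Longrightarrow> ((x, m), (y, n)) \<in> \<rho>"
begin

text \<open>The set \<open>Y\<close> of the overview. A path of letters from some \<open>g x\<close>
  into \<open>B\<close> either starts in \<open>B\<close> or enters it by one letter from a point of
  \<open>A - B\<close>; these are the possible entry points.\<close>

definition gens :: "'a set" where
  "gens = (g ` X \<union> (\<lambda>(c, z). act c (\<phi> [z])) ` ((A - B) \<times> Z)) \<inter> B"

abbreviation free :: "('a \<times> 'm) set" where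
  "free \<equiv> gens \<times> carrier M"

text \<open>A point \<open>c\<close> of \<open>A - B\<close> is encoded as \<open>(c, \<one>)\<close>, so that the value of every state
  \<open>(a, m)\<close> is \<open>a m\<close>.\<close>

definition states :: "('a \<times> 'm) set" where
  "states = free \<union> (A - B) \<times> {\<one>}"

definition val :: "'a \<times> 'm \<Rightarrow> 'a" where
  "val s = act (fst s) (snd s)"

text \<open>The second branch serves two cases: the new first component is either a point of
  \<open>A - B\<close> again or, by the choice of \<open>gens\<close>, a generator, and then the
  pair is its copy in the free act.\<close>

definition step :: "'a \<times> 'm \<Rightarrow> 'z \<Rightarrow> 'a \<times> 'm" where
  "step s z = (if fst s \<in> B then (fst s, snd s \<otimes> \<phi> [z]) else (act (fst s) (\<phi> [z]), \<one>))"

definition run :: "'a \<times> 'm \<Rightarrow> 'z list \<Rightarrow> 'a \<times> 'm" where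
  "run = foldl step"

text \<open>An arbitrary choice of representatives. It need not be multiplicative; the effect of
  this on states is controlled by \<open>eqv_run_words\<close>.\<close>

definition word :: "'m \<Rightarrow> 'z list" where
  "word = inv_into (lists Z) \<phi>"

text \<open>The Reidemeister rewriting map from the free act on \<open>X\<close> to the states. It
  preserves values, but is shown to be equivariant only modulo \<open>eqv\<close>.\<close>

definition trace :: "'g \<times> 'm \<Rightarrow> 'a \<times> 'm" where
  "trace p = run (g (fst p), \<one>) (word (snd p))"

text \<open>The intersection loses nothing: by \<open>same_val_cases\<close>, a discarded pair has
  two equal sides.\<close>

definition rels :: "(('a \<times> 'm) \<times> ('a \<times> 'm)) set" where
  "rels = ((\<lambda>(c, p, q). (run (c, \<one>) p, run (c, \<one>) q)) ` ((A - B) \<times> P) \<union> map_prod trace trace ` R)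
     \<inter> free \<times> free"

lemma B_sub: "B \<subseteq> A" and B_closed: "\<lbrakk>b \<in> B; m \<in> carrier M\<rbrakk> \<Longrightarrow> act b m \<in> B"
  using sub by (auto simp: subact_def)

lemma gens_sub: "gens \<subseteq> B"
  by (auto simp: gens_def)

lemma finite_gens: "finite gens"
  using X Z finite_diff by (simp add: gens_def)

lemma finite_rels: "finite rels"
  using P R finite_diff by (simp add: rels_def)

lemma \<phi>_closed: "u \<in> lists Z \<Longrightarrow> \<phi> u \<in> carrier M"
  using \<phi>_surj by blast

lemma word_in: "m \<in> carrier M \<Longrightarrow> word m \<in> lists Z"
  and \<phi>_word: "m \<in> carrier M \<Longrightarrow> \<phi> (word m) = m"
  using \<phi>_surj by (simp_all add: word_def inv_into_into f_inv_into_f)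

lemma run_Nil: "run s [] = s" and run_Cons: "run s (z # w) = run (step s z) w"
  and run_append: "run s (u @ v) = run (run s u) v"
  by (simp_all add: run_def)

lemma step_states: "\<lbrakk>s \<in> states; z \<in> Z\<rbrakk> \<Longrightarrow> step s z \<in> states"
  using gens_sub \<phi>_closed[of "[z]"] act_closed[of "fst s" "\<phi> [z]"]
  by (auto simp: states_def step_def) (auto simp: gens_def)

lemma run_states: "\<lbrakk>s \<in> states; w \<in> lists Z\<rbrakk> \<Longrightarrow> run s w \<in> states"
  by (induction w arbitrary: s) (auto simp: run_Nil run_Cons step_states)

lemma states_in: "(a, m) \<in> states \<Longrightarrow> a \<in> A \<and> m \<in> carrier M"
  using gens_sub B_sub by (auto simp: states_def)

lemma val_step: "\<lbrakk>s \<in> states; z \<in> Z\<rbrakk> \<Longrightarrow> val (step s z) = act (val s) (\<phi> [z])"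
  using states_in[of "fst s" "snd s"] \<phi>_closed[of "[z]"] gens_sub
  by (auto simp: val_def step_def states_def act_mult act_one act_closed)

lemma val_closed: "s \<in> states \<Longrightarrow> val s \<in> A"
  using states_in[of "fst s" "snd s"] act_closed by (simp add: val_def)

lemma \<phi>_Cons: "\<lbrakk>z \<in> Z; w \<in> lists Z\<rbrakk> \<Longrightarrow> \<phi> (z # w) = \<phi> [z] \<otimes> \<phi> w"
  using \<phi>_append[of "[z]" w] by simp

lemma val_run: "\<lbrakk>s \<in> states; w \<in> lists Z\<rbrakk> \<Longrightarrow> val (run s w) = act (val s) (\<phi> w)"
proof (induction w arbitrary: s)
  case Nil
  then show ?case
    by (simp add: run_Nil \<phi>_Nil act_one val_closed)
next
  case (Cons z w)
  then have zw: "z \<in> Z" "w \<in> lists Z" by auto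
  then show ?case
    using Cons.IH[OF step_states[OF Cons.prems(1) zw(1)] zw(2)] Cons.prems(1) \<phi>_closed[of "[z]"] \<phi>_closed[of w]
    by (simp add: run_Cons val_step \<phi>_Cons[OF zw] act_mult val_closed)
qed

lemma run_free: "\<lbrakk>y \<in> B; m \<in> carrier M; w \<in> lists Z\<rbrakk> \<Longrightarrow> run (y, m) w = (y, m \<otimes> \<phi> w)"
proof (induction w arbitrary: m)
  case (Cons z w)
  then have zw: "z \<in> Z" "w \<in> lists Z" by auto
  then show ?case
    using Cons.IH[OF Cons.prems(1) _ zw(2), of "m \<otimes> \<phi> [z]"] Cons.prems(1,2)
      \<phi>_closed[of "[z]"] \<phi>_closed[of w]
    by (simp add: run_Cons step_def \<phi>_Cons[OF zw] m_assoc)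
qed (simp add: run_Nil \<phi>_Nil)

lemma val_in_B: "s \<in> states \<Longrightarrow> val s \<in> B \<longleftrightarrow> s \<in> free"
  using gens_sub B_closed act_one by (auto simp: states_def val_def)

text \<open>By \<open>val_in_B\<close> the value decides whether a state lies in
  \<open>free\<close>, and outside \<open>free\<close> a state \<open>(c, \<one>)\<close> is
  recovered from its value \<open>c\<close>.\<close>

lemma same_val_cases:
  assumes "s \<in> states" "t \<in> states" "val s = val t"
  shows "s = t \<or> s \<in> free \<and> t \<in> free"
proof (cases "val s \<in> B")
  case True
  then show ?thesis
    using assms val_in_B by metis
next
  case False
  then have "s \<in> (A - B) \<times> {\<one>}" "t \<in> (A - B) \<times> {\<one>}"
    using assms val_in_B by (metis UnE states_def)+
  then show ?thesis
    using assms(3) act_one by (auto simp: val_def)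
qed

lemma start_states: "x \<in> X \<Longrightarrow> (g x, \<one>) \<in> states"
  using g_in by (auto simp: states_def gens_def)

lemma trace_states: "p \<in> X \<times> carrier M \<Longrightarrow> trace p \<in> states"
  by (auto simp: trace_def intro!: run_states start_states word_in)

lemma val_trace: "\<lbrakk>x \<in> X; m \<in> carrier M\<rbrakk> \<Longrightarrow> val (trace (x, m)) = act (g x) m"
  using start_states[of x] word_in[of m] g_in act_one[of "g x"]
  by (auto simp: trace_def val_run \<phi>_word) (auto simp: val_def)

text \<open>If \<open>b\<close> is the value of \<open>(x, m)\<close>, its trace also has value
  \<open>b\<close>. As \<open>b\<close> lies in \<open>B\<close>, the trace lies in
  \<open>free\<close>, and its components are the generator and the multiplier sought.\<close>

lemma gens_generate:
  assumes "b \<in> B"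
  shows "\<exists>y\<in>gens. \<exists>m\<in>carrier M. b = act y m"
proof -
  obtain x m where xm: "x \<in> X" "m \<in> carrier M" "b = act (g x) m"
    using g_gen assms B_sub by blast
  then have "trace (x, m) \<in> free"
    using val_trace[of x m] val_in_B[OF trace_states[of "(x, m)"]] assms by simp
  then show ?thesis
    using val_trace[OF xm(1,2)] xm(3) unfolding val_def by (metis mem_Times_iff)
qed

text \<open>Both kinds of relation compare states of equal value, because \<phi> respects
  \<open>P\<close> and \<open>g\<close> respects \<open>R\<close>.\<close>

lemma rels_val:
  assumes "((x, m), (y, n)) \<in> rels"
  shows "act x m = act y n"
proof -
  have "val (x, m) = val (y, n)"
    using assms unfolding rels_def
  proof (elim IntE UnE imageE)
    fix k assume "k \<in> (A - B) \<times> P"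
      "((x, m), (y, n)) = (case k of (c, p, q) \<Rightarrow> (run (c, \<one>) p, run (c, \<one>) q))"
    then obtain c p q where "c \<in> A - B" "(p, q) \<in> P"
      "(x, m) = run (c, \<one>) p" "(y, n) = run (c, \<one>) q"
      by auto
    moreover from this have "(c, \<one>) \<in> states"
      by (simp add: states_def)
    moreover have "p \<in> lists Z" "q \<in> lists Z"
      using P(2) \<open>(p, q) \<in> P\<close> by blast+
    ultimately show ?thesis
      using \<phi>_rel by (simp add: val_run)
  next
    fix k assume k: "k \<in> R" "((x, m), (y, n)) = map_prod trace trace k"
    obtain x' m' y' n' where "k = ((x', m'), (y', n'))"
      by (metis surj_pair)
    then show ?thesis
      using k R(2) g_rel[of x' m' y' n'] val_trace[of x' m'] val_trace[of y' n'] by auto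
  qed
  then show ?thesis
    by (simp add: val_def)
qed

section \<open>Congruences on the free act that contain the relations\<close>

context
  fixes \<sigma> assumes \<sigma>: "act_congruence M free (free_action M) \<sigma>" and rels_\<sigma>: "rels \<subseteq> \<sigma>"
begin

lemma \<sigma>_equiv: "equiv free \<sigma>"
  using \<sigma> by (simp add: act_congruence_def)

text \<open>Extends \<sigma> from \<open>free\<close> to all states, each point of
  \<open>A - B\<close> being related to itself only.\<close>

definition eqv :: "'a \<times> 'm \<Rightarrow> 'a \<times> 'm \<Rightarrow> bool" where
  "eqv s t \<longleftrightarrow> s = t \<or> (s, t) \<in> \<sigma>"

lemma eqv_refl: "eqv s s"
  by (simp add: eqv_def)

lemma eqv_sym: "eqv s t \<Longrightarrow> eqv t s"
  using \<sigma>_equiv by (auto simp: eqv_def equiv_def dest: symD)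

lemma eqv_trans [trans]: "eqv s t \<Longrightarrow> eqv t r \<Longrightarrow> eqv s r"
  using \<sigma>_equiv by (auto simp: eqv_def equiv_def dest: transD)

text \<open>On \<open>free\<close>, reading \<open>w\<close> is the free action of
  \<open>\<phi> w\<close>, under which \<sigma> is stable; elsewhere related states are
  equal.\<close>

lemma eqv_run:
  assumes "eqv s t" "w \<in> lists Z"
  shows "eqv (run s w) (run t w)"
proof (cases "s = t")
  case False
  then have st: "(s, t) \<in> \<sigma>"
    using assms by (simp add: eqv_def)
  then have "s \<in> free" "t \<in> free"
    using \<sigma>_equiv by (auto simp: equiv_def)
  then have "run s w = free_action M s (\<phi> w)" "run t w = free_action M t (\<phi> w)"
    using gens_sub assms(2) by (auto simp: free_action_def run_free subset_iff)
  then show ?thesis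
    using \<sigma> st \<phi>_closed[OF assms(2)] unfolding eqv_def act_congruence_def by metis
qed (simp add: eqv_refl)

text \<open>On \<open>free\<close> both runs multiply by the same element
  \<open>\<phi> p = \<phi> q\<close>. From a point of \<open>A - B\<close> they end with equal
  values, so they coincide or form a pair of \<open>rels\<close>.\<close>

lemma eqv_run_rel:
  assumes "(p, q) \<in> P" "s \<in> states"
  shows "eqv (run s p) (run s q)"
proof (cases "s \<in> free")
  case True
  then show ?thesis
    using assms P(2) gens_sub \<phi>_rel[OF assms(1)] by (auto simp: run_free eqv_def subset_iff)
next
  case False
  then obtain c where c: "c \<in> A - B" "s = (c, \<one>)"
    using assms(2) by (auto simp: states_def)
  have pq: "p \<in> lists Z" "q \<in> lists Z"
    using assms(1) P(2) by blast+
  have "run s p = run s q \<or> run s p \<in> free \<and> run s q \<in> free"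
    using assms(2) pq \<phi>_rel[OF assms(1)] by (intro same_val_cases) (simp_all add: run_states val_run)
  moreover have "(run s p, run s q) \<in> rels" if "run s p \<in> free" "run s q \<in> free"
    using that c assms(1) by (force simp: rels_def)
  ultimately show ?thesis
    using rels_\<sigma> by (auto simp: eqv_def)
qed

text \<open>The pairs of words with the same effect on every state modulo \<open>eqv\<close> form a
  monoid congruence containing \<open>P\<close>, hence containing the kernel of \<phi>. Thus
  \<open>M\<close> acts on the states modulo \<open>eqv\<close>.\<close>

lemma eqv_run_words:
  assumes "u \<in> lists Z" "v \<in> lists Z" "\<phi> u = \<phi> v" "s \<in> states"
  shows "eqv (run s u) (run s v)"
proof -
  define \<rho> where "\<rho> = {(u, v). u \<in> lists Z \<and> v \<in> lists Z \<and> (\<forall>s\<in>states. eqv (run s u) (run s v))}"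
  have "monoid_congruence (free_monoid Z) \<rho>"
    unfolding monoid_congruence_def
  proof (intro conjI allI impI)
    have "equiv (lists Z) \<rho>"
    proof (rule equivI)
      show "sym \<rho>"
        unfolding sym_def \<rho>_def using eqv_sym by blast
      show "trans \<rho>"
        unfolding trans_def \<rho>_def using eqv_trans by blast
    qed (auto simp: \<rho>_def refl_on_def eqv_refl)
    then show "equiv (carrier (free_monoid Z)) \<rho>"
      by (simp add: free_monoid_def)
    fix a b c d assume ab: "(a, b) \<in> \<rho>" and cd: "(c, d) \<in> \<rho>"
    have "eqv (run s (a @ c)) (run s (b @ d))" if "s \<in> states" for s
    proof -
      \<comment> \<open>First the prefix \<open>a\<close> is replaced, using that \<open>eqv\<close>
        survives reading \<open>c\<close>; then \<open>c\<close> is replaced at the state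
        \<open>run s b\<close>.\<close>
      have "eqv (run (run s a) c) (run (run s b) c)"
        using ab cd that by (intro eqv_run) (auto simp: \<rho>_def)
      also have "eqv \<dots> (run (run s b) d)"
        using ab cd that by (auto simp: \<rho>_def run_states)
      finally show ?thesis
        by (simp add: run_append)
    qed
    then show "(a \<otimes>\<^bsub>free_monoid Z\<^esub> c, b \<otimes>\<^bsub>free_monoid Z\<^esub> d) \<in> \<rho>"
      using ab cd by (auto simp: \<rho>_def free_monoid_def)
  qed
  moreover have "P \<subseteq> \<rho>"
    using P(2) eqv_run_rel by (auto simp: \<rho>_def)
  ultimately have "(u, v) \<in> \<rho>"
    using \<phi>_ker assms(1-3) by blast
  then show ?thesis
    using assms(4) by (simp add: \<rho>_def)
qed

text \<open>The words \<open>word (m \<otimes> \<phi> w)\<close> and \<open>word m @ w\<close>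
  represent the same element of \<open>M\<close>.\<close>

lemma eqv_trace_mult:
  assumes "x \<in> X" "m \<in> carrier M" "w \<in> lists Z"
  shows "eqv (trace (x, m \<otimes> \<phi> w)) (run (trace (x, m)) w)"
proof -
  have "eqv (run (g x, \<one>) (word (m \<otimes> \<phi> w))) (run (g x, \<one>) (word m @ w))"
    using assms word_in[of m] word_in[of "m \<otimes> \<phi> w"] \<phi>_closed[OF assms(3)] start_states
    by (intro eqv_run_words) (auto simp: \<phi>_word \<phi>_append)
  then show ?thesis
    by (simp add: trace_def run_append)
qed

text \<open>The kernel of \<open>trace\<close> modulo \<open>eqv\<close> is an act congruence on the
  free act on \<open>X\<close>. It contains \<open>R\<close>, since the traces of a related pair
  have equal values and so coincide or lie in \<open>rels\<close>. Now \<open>g_ker\<close>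
  applies.\<close>

lemma eqv_trace:
  assumes "x \<in> X" "y \<in> X" "m \<in> carrier M" "n \<in> carrier M" "act (g x) m = act (g y) n"
  shows "eqv (trace (x, m)) (trace (y, n))"
proof -
  define \<rho> where "\<rho> = {(p, q). p \<in> X \<times> carrier M \<and> q \<in> X \<times> carrier M \<and> eqv (trace p) (trace q)}"
  have "act_congruence M (X \<times> carrier M) (free_action M) \<rho>"
    unfolding act_congruence_def
  proof (intro conjI allI ballI impI)
    show "equiv (X \<times> carrier M) \<rho>"
    proof (rule equivI)
      show "sym \<rho>"
        unfolding sym_def \<rho>_def using eqv_sym by blast
      show "trans \<rho>"
        unfolding trans_def \<rho>_def using eqv_trans by blast
    qed (auto simp: \<rho>_def refl_on_def eqv_refl)
    fix p q k assume k: "k \<in> carrier M" and pq: "(p, q) \<in> \<rho>"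
    have act: "eqv (trace (free_action M p k)) (run (trace p) (word k))"
      if "p \<in> X \<times> carrier M" for p
      using that eqv_trace_mult[of "fst p" "snd p" "word k"] word_in[OF k] \<phi>_word[OF k]
      by (auto simp: free_action_def)
    note act[of p]
    also have "eqv (run (trace p) (word k)) (run (trace q) (word k))"
      using pq word_in[OF k] by (intro eqv_run) (auto simp: \<rho>_def)
    also have "eqv (run (trace q) (word k)) (trace (free_action M q k))"
      using pq by (intro eqv_sym[OF act]) (simp add: \<rho>_def)
    finally show "(free_action M p k, free_action M q k) \<in> \<rho>"
      using pq k by (auto simp: \<rho>_def) (auto simp: free_action_def)
  qed
  moreover have "R \<subseteq> \<rho>"
  proof
    fix r assume r: "r \<in> R"
    obtain x m y n where r_eq: "r = ((x, m), (y, n))"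
      by (metis surj_pair)
    then have in_F: "(x, m) \<in> X \<times> carrier M" "(y, n) \<in> X \<times> carrier M"
      using r R(2) by auto
    have "trace (x, m) = trace (y, n) \<or> trace (x, m) \<in> free \<and> trace (y, n) \<in> free"
      using in_F r r_eq g_rel[of x m y n]
      by (intro same_val_cases trace_states) (auto simp: val_trace)
    moreover have "(trace (x, m), trace (y, n)) \<in> rels"
      if "trace (x, m) \<in> free" "trace (y, n) \<in> free"
      using that r r_eq by (force simp: rels_def)
    ultimately show "r \<in> \<rho>"
      using in_F r_eq rels_\<sigma> by (auto simp: \<rho>_def eqv_def)
  qed
  ultimately have "((x, m), (y, n)) \<in> \<rho>"
    using g_ker assms by blast
  then show ?thesis
    by (simp add: \<rho>_def)
qed

text \<open>The start of surjectivity of \<open>trace\<close> modulo \<open>eqv\<close>: a generator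
  \<open>g x\<close> is reached from \<open>(x, \<one>)\<close>, and a generator \<open>c z\<close>
  by reading \<open>z\<close> after a trace that ends at \<open>c\<close>.\<close>

lemma gen_eqv_trace:
  assumes "y \<in> gens"
  shows "\<exists>x\<in>X. \<exists>m\<in>carrier M. act (g x) m = y \<and> eqv (trace (x, m)) (y, \<one>)"
proof -
  consider x where "x \<in> X" "y = g x" | c z where "c \<in> A - B" "z \<in> Z" "y = act c (\<phi> [z])"
    using assms by (auto simp: gens_def)
  then show ?thesis
  proof cases
    case 1
    \<comment> \<open>The chosen word for \<open>\<one>\<close> may be nonempty, so it has to be
      compared with the empty word.\<close>
    have "eqv (run (g x, \<one>) (word \<one>)) (run (g x, \<one>) [])"
      using 1 start_states word_in[of \<one>]
      by (intro eqv_run_words) (auto simp: \<phi>_word \<phi>_Nil)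
    then show ?thesis
      using 1 g_in act_one[of "g x"]
      by (intro bexI[of _ x] bexI[of _ \<one>]) (auto simp: trace_def run_Nil)
  next
    case 2
    obtain x m where xm: "x \<in> X" "m \<in> carrier M" "c = act (g x) m"
      using g_gen 2(1) by blast
    have "trace (x, m) = (c, \<one>) \<or> trace (x, m) \<in> free \<and> (c, \<one>) \<in> free"
      using xm 2(1) act_one[of c] val_trace[OF xm(1,2)]
      by (intro same_val_cases trace_states) (auto simp: states_def val_def)
    \<comment> \<open>The other alternative fails because \<open>c\<close> lies outside
      \<open>B\<close>, so \<open>(c, \<one>)\<close> is not in \<open>free\<close>.\<close>
    then have "trace (x, m) = (c, \<one>)"
      using 2(1) gens_sub by auto
    then have "run (trace (x, m)) [z] = (y, \<one>)"
      using 2 by (simp add: run_Cons run_Nil step_def)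
    then have "eqv (trace (x, m \<otimes> \<phi> [z])) (y, \<one>)"
      using eqv_trace_mult[of x m "[z]"] xm 2(2) by simp
    then show ?thesis
      using xm 2 g_in \<phi>_closed[of "[z]"] act_mult[of "g x" m "\<phi> [z]"]
      by (intro bexI[of _ x] bexI[of _ "m \<otimes> \<phi> [z]"]) auto
  qed
qed

text \<open>Reading \<open>word n\<close> on both sides of \<open>gen_eqv_trace\<close> multiplies
  the generator by \<open>n\<close>.\<close>

lemma free_eqv_trace:
  assumes "y \<in> gens" "n \<in> carrier M"
  shows "\<exists>x\<in>X. \<exists>m\<in>carrier M. act (g x) m = act y n \<and> eqv (trace (x, m)) (y, n)"
proof -
  obtain x m where xm: "x \<in> X" "m \<in> carrier M" "act (g x) m = y"
    "eqv (trace (x, m)) (y, \<one>)"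
    using gen_eqv_trace[OF assms(1)] by blast
  have "eqv (trace (x, m \<otimes> n)) (run (trace (x, m)) (word n))"
    using eqv_trace_mult[OF xm(1,2) word_in[OF assms(2)]] assms(2) by (simp add: \<phi>_word)
  also have "eqv \<dots> (run (y, \<one>) (word n))"
    using xm(4) word_in[OF assms(2)] by (rule eqv_run)
  also have "run (y, \<one>) (word n) = (y, n)"
    using assms gens_sub word_in[OF assms(2)] run_free[of y \<one> "word n"] by (auto simp: \<phi>_word)
  finally have "eqv (trace (x, m \<otimes> n)) (y, n)" .
  moreover have "act (g x) (m \<otimes> n) = act y n"
    using xm(1-3) g_in assms(2) act_mult[of "g x" m n] by auto
  ultimately show ?thesis
    using xm(1,2) assms(2) by blast
qed

text \<open>Both pairs are replaced by traces of elements of the free act on \<open>X\<close>. These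
  have equal values in \<open>A\<close>, so the presentation of \<open>A\<close> relates them
  through \<open>eqv_trace\<close>.\<close>

lemma \<sigma>_minimal:
  assumes "x \<in> gens" "y \<in> gens" "m \<in> carrier M" "n \<in> carrier M" "act x m = act y n"
  shows "((x, m), (y, n)) \<in> \<sigma>"
proof -
  obtain x' m' where x': "x' \<in> X" "m' \<in> carrier M" "act (g x') m' = act x m"
    "eqv (trace (x', m')) (x, m)"
    using free_eqv_trace assms by blast
  obtain y' n' where y': "y' \<in> X" "n' \<in> carrier M" "act (g y') n' = act y n"
    "eqv (trace (y', n')) (y, n)"
    using free_eqv_trace assms by blast
  have "eqv (x, m) (trace (x', m'))"
    using x'(4) by (rule eqv_sym)
  also have "eqv \<dots> (trace (y', n'))"
    using x' y' assms(5) by (intro eqv_trace) simp_all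
  also have "eqv \<dots> (y, n)"
    by (rule y'(4))
  \<comment> \<open>If \<open>eqv\<close> holds by equality, reflexivity of \<sigma> on
    \<open>free\<close> supplies the pair.\<close>
  finally show ?thesis
    using \<sigma>_equiv assms(1,3) by (auto simp: eqv_def equiv_def refl_on_def)
qed

end

lemma finitely_presented_subact: "finitely_presented_act M B act"
proof (rule finitely_presented_actI[of M B act gens rels])
  show "right_act M B act"
    using right_act_subact[OF right_act_axioms sub] .
  show "rels \<subseteq> free \<times> free"
    by (auto simp: rels_def)
qed (use gens_sub finite_gens finite_rels gens_generate rels_val \<sigma>_minimal in blast)+

end

theorem theorem6p14:
  fixes M :: "('m, 'x) monoid_scheme"
    and A B :: "'a set"
    and act :: "'a \<Rightarrow> 'm \<Rightarrow> 'a"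
  assumes "finitely_presented_monoid M"
    and "right_act M A act"
    and "large_subact M A act B"
    and "finitely_presented_act M A act"
  shows "finitely_presented_act M B act"
proof -
  obtain Z :: "nat set" and P \<phi> where Z:
    "finite Z" "finite P" "P \<subseteq> lists Z \<times> lists Z"
    "\<phi> ` lists Z = carrier M" "\<phi> [] = \<one>\<^bsub>M\<^esub>"
    "\<And>u v. u \<in> lists Z \<Longrightarrow> v \<in> lists Z \<Longrightarrow> \<phi> (u @ v) = \<phi> u \<otimes>\<^bsub>M\<^esub> \<phi> v"
    "\<And>u v. (u, v) \<in> P \<Longrightarrow> \<phi> u = \<phi> v"
    "\<And>\<rho> u v. monoid_congruence (free_monoid Z) \<rho> \<Longrightarrow> P \<subseteq> \<rho> \<Longrightarrow>
      u \<in> lists Z \<Longrightarrow> v \<in> lists Z \<Longrightarrow> \<phi> u = \<phi> v \<Longrightarrow> (u, v) \<in> \<rho>"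
    by (rule finitely_presented_monoidE[OF assms(1)]) (rule that)
  obtain X :: "nat set" and R g where X:
    "finite X" "finite R" "R \<subseteq> (X \<times> carrier M) \<times> (X \<times> carrier M)" "g ` X \<subseteq> A"
    "\<And>a. a \<in> A \<Longrightarrow> \<exists>x\<in>X. \<exists>m\<in>carrier M. a = act (g x) m"
    "\<And>x m y n. ((x, m), (y, n)) \<in> R \<Longrightarrow> act (g x) m = act (g y) n"
    "\<And>\<rho> x m y n. act_congruence M (X \<times> carrier M) (free_action M) \<rho> \<Longrightarrow> R \<subseteq> \<rho> \<Longrightarrow>
      x \<in> X \<Longrightarrow> y \<in> X \<Longrightarrow> m \<in> carrier M \<Longrightarrow> n \<in> carrier M \<Longrightarrow>
      act (g x) m = act (g y) n \<Longrightarrow> ((x, m), (y, n)) \<in> \<rho>"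
    by (rule finitely_presented_actE[OF assms(4)]) (rule that)
  have B: "subact M A act B" "finite (A - B)"
    using assms(3) by (simp_all add: large_subact_def)
  interpret presented_large_subact M A act B Z P \<phi> X R g
    using assms(2) B Z X by (intro presented_large_subact.intro presented_large_subact_axioms.intro)
  show ?thesis
    by (rule finitely_presented_subact)
qed

end
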